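(* For each positive integer $m$, let $D_{\mathbb{R},m}$ be the infimum of all $D>0$ such that $|P|_{\frac{2m}{m+1}}\le D\,\|P\|$ for every $n\in\mathbb{N}$ and every $m$-homogeneous polynomial $P$ on $\mathbb{R}^n$ with real coefficients, where $\|P\|=\max_{x\in[-1,1]^n}|P(x)|$. Then $$D_{\mathbb{R},m}>\left(\frac{2\sqrt[4]{3}}{\sqrt{5}}\right)^{m}>(1.17)^m$$ for all integers $m>1$.
   Context: An $m$-homogeneous polynomial on $\mathbb{R}^n$ is written $P(x)=\sum_{|\alpha|=m}a_\alpha x^\alpha$, where $\alpha=(\alpha_1,\dots,\alpha_n)\in(\mathbb{N}\cup\{0\})^n$, $|\alpha|=\alpha_1+\cdots+\alpha_n$, $x^\alpha=x_1^{\alpha_1}\cdots x_n^{\alpha_n}$, and $a_\alpha\in\mathbb{R}$. For $p\ge 1$, $|P|_p=\left(\sum_{|\alpha|=m}|a_\alpha|^p\right)^{1/p}$ is the $\ell_p$ norm of the coefficients. The polynomial norm is $\|P\|=\sup\{|P(x)|: x\in\mathbb{R}^n,\ \max_i|x_i|\le 1\}$. By the Bohnenblust--Hille theorem, $D_{\mathbb{R},m}<\infty$ for every $m$. *)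

theory Defs
  imports "HOL-Analysis.Analysis"
begin

text \<open>
  An \<open>m\<close>-homogeneous polynomial in \<open>n\<close> variables is given by its coefficient family
  \<open>a\<close>, of which only the values on \<open>multi_indices n m\<close> matter. Points of \<open>\<real>\<^sup>n\<close> and multi-indices
  are functions on \<open>nat\<close> whose relevant arguments are \<open>0, \<dots>, n - 1\<close>; multi-indices are padded
  with \<open>0\<close> so that each one is represented exactly once.
\<close>

definition multi_indices :: "nat \<Rightarrow> nat \<Rightarrow> (nat \<Rightarrow> nat) set" where
  "multi_indices n m = {\<alpha>. (\<forall>i\<ge>n. \<alpha> i = 0) \<and> (\<Sum>i<n. \<alpha> i) = m}"

definition hpoly :: "nat \<Rightarrow> nat \<Rightarrow> ((nat \<Rightarrow> nat) \<Rightarrow> real) \<Rightarrow> (nat \<Rightarrow> real) \<Rightarrow> real" where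
  "hpoly n m a x = (\<Sum>\<alpha>\<in>multi_indices n m. a \<alpha> * (\<Prod>i<n. x i ^ \<alpha> i))"

definition coeff_norm :: "real \<Rightarrow> nat \<Rightarrow> nat \<Rightarrow> ((nat \<Rightarrow> nat) \<Rightarrow> real) \<Rightarrow> real" where
  "coeff_norm p n m a = (\<Sum>\<alpha>\<in>multi_indices n m. \<bar>a \<alpha>\<bar> powr p) powr (1 / p)"

definition poly_norm :: "nat \<Rightarrow> nat \<Rightarrow> ((nat \<Rightarrow> nat) \<Rightarrow> real) \<Rightarrow> real" where
  "poly_norm n m a = (SUP x\<in>{..<n} \<rightarrow>\<^sub>E {-1..1}. \<bar>hpoly n m a x\<bar>)"

text \<open>
  The infimum is taken in the extended reals, so that it is meaningful (namely \<open>\<infinity>\<close>) without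
  presupposing that an admissible constant exists; the Bohnenblust--Hille theorem says that
  it is finite.
\<close>

definition BH_const :: "nat \<Rightarrow> ereal" where
  "BH_const m = Inf {ereal D |D. D > 0 \<and>
     (\<forall>n\<ge>1. \<forall>a. coeff_norm (2 * real m / (real m + 1)) n m a \<le> D * poly_norm n m a)}"

end

theory Submission
  imports Defs
begin

text \<open>
  The polynomial \<open>x\<^sup>2 + x y - y\<^sup>2\<close> has three coefficients of modulus \<open>1\<close> and norm at most \<open>5/4\<close>
  on the square. A product of \<open>k\<close> copies in disjoint variables has \<open>3 ^ k\<close> coefficients of
  modulus \<open>1\<close> and norm at most \<open>(5/4) ^ k\<close>; for odd \<open>m\<close> one more linear factor in a new variable
  is used. The comparison of the two norms then gives the bound, with the margin \<open>3 powr (1/4)\<close> for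
  even \<open>m\<close>, and, since \<open>3 < (5/4) ^ 6\<close>, with a margin above \<open>1\<close> for odd \<open>m \<ge> 3\<close>.
\<close>

section \<open>Products of polynomials in disjoint sets of variables\<close>

definition join_index :: "nat \<Rightarrow> (nat \<Rightarrow> 'a) \<Rightarrow> (nat \<Rightarrow> 'a) \<Rightarrow> nat \<Rightarrow> 'a" where
  "join_index n \<beta> \<gamma> = (\<lambda>i. if i < n then \<beta> i else \<gamma> (i - n))"

definition head_index :: "nat \<Rightarrow> (nat \<Rightarrow> nat) \<Rightarrow> nat \<Rightarrow> nat" where
  "head_index n \<alpha> = (\<lambda>i. if i < n then \<alpha> i else 0)"

definition tail_index :: "nat \<Rightarrow> (nat \<Rightarrow> 'a) \<Rightarrow> nat \<Rightarrow> 'a" where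
  "tail_index n \<alpha> = (\<lambda>i. \<alpha> (n + i))"

text \<open>Coefficients of P(x) Q(y), with P of degree \<open>m\<close> in the first
  \<open>n\<close> variables. A multi-index of the right total degree may still distribute it
  differently over the two blocks; such monomials do not occur in the product, hence the value
  \<open>0\<close>.\<close>

definition coeff_tensor ::
  "nat \<Rightarrow> nat \<Rightarrow> ((nat \<Rightarrow> nat) \<Rightarrow> real) \<Rightarrow> ((nat \<Rightarrow> nat) \<Rightarrow> real) \<Rightarrow> (nat \<Rightarrow> nat) \<Rightarrow> real" where
  "coeff_tensor n m a b \<alpha> =
     (if head_index n \<alpha> \<in> multi_indices n m then a (head_index n \<alpha>) * b (tail_index n \<alpha>) else 0)"

lemma finite_multi_indices: "finite (multi_indices n m)"
proof (rule finite_subset)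
  show "multi_indices n m \<subseteq> {\<alpha>. \<forall>i. (i \<in> {..<n} \<longrightarrow> \<alpha> i \<in> {..m}) \<and> (i \<notin> {..<n} \<longrightarrow> \<alpha> i = 0)}"
    by (auto simp: multi_indices_def intro: member_le_sum)
  show "finite {\<alpha>. \<forall>i. (i \<in> {..<n} \<longrightarrow> \<alpha> i \<in> {..m}) \<and> (i \<notin> {..<n} \<longrightarrow> \<alpha> i = (0::nat))}"
    by (rule finite_set_of_finite_funs) auto
qed

lemma head_index_join:
  "\<beta> \<in> multi_indices n m \<Longrightarrow> head_index n (join_index n \<beta> \<gamma>) = \<beta>"
  by (auto simp: head_index_def join_index_def multi_indices_def)

lemma tail_index_join: "tail_index n (join_index n \<beta> \<gamma>) = \<gamma>"
  by (auto simp: tail_index_def join_index_def)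

lemma join_head_tail: "join_index n (head_index n \<alpha>) (tail_index n \<alpha>) = \<alpha>"
  by (auto simp: head_index_def tail_index_def join_index_def)

lemma sum_lessThan_add_split:
  fixes f :: "nat \<Rightarrow> 'a::comm_monoid_add"
  shows "(\<Sum>i<n + k. f i) = (\<Sum>i<n. f i) + (\<Sum>i<k. f (n + i))"
  by (induction k) (simp_all add: add.assoc)

lemma prod_lessThan_add_split:
  fixes f :: "nat \<Rightarrow> 'a::comm_monoid_mult"
  shows "(\<Prod>i<n + k. f i) = (\<Prod>i<n. f i) * (\<Prod>i<k. f (n + i))"
  by (induction k) (simp_all add: mult.assoc)

lemma join_index_mem:
  assumes "\<beta> \<in> multi_indices n m" "\<gamma> \<in> multi_indices n' m'"
  shows "join_index n \<beta> \<gamma> \<in> multi_indices (n + n') (m + m')"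
  using assms by (auto simp: multi_indices_def join_index_def sum_lessThan_add_split)

lemma tail_index_mem:
  assumes "\<alpha> \<in> multi_indices (n + n') (m + m')" "head_index n \<alpha> \<in> multi_indices n m"
  shows "tail_index n \<alpha> \<in> multi_indices n' m'"
  using assms by (auto simp: multi_indices_def head_index_def tail_index_def sum_lessThan_add_split)

text \<open>Multi-indices whose head has degree \<open>m\<close> correspond bijectively to pairs of
  head and tail, the tail then having degree \<open>m'\<close>. The assumption on \<open>F\<close>
  discards all the others.\<close>

lemma sum_multi_indices_join:
  fixes F :: "(nat \<Rightarrow> nat) \<Rightarrow> real"
  assumes "\<And>\<alpha>. head_index n \<alpha> \<notin> multi_indices n m \<Longrightarrow> F \<alpha> = 0"
  shows "(\<Sum>\<alpha>\<in>multi_indices (n + n') (m + m'). F \<alpha>) =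
         (\<Sum>\<beta>\<in>multi_indices n m. \<Sum>\<gamma>\<in>multi_indices n' m'. F (join_index n \<beta> \<gamma>))"
proof -
  let ?A = "multi_indices (n + n') (m + m')"
  have "(\<Sum>\<alpha>\<in>?A. F \<alpha>) = (\<Sum>\<alpha>\<in>{\<alpha>\<in>?A. head_index n \<alpha> \<in> multi_indices n m}. F \<alpha>)"
    by (rule sum.mono_neutral_right) (auto simp: finite_multi_indices assms)
  also have "\<dots> = (\<Sum>(\<beta>, \<gamma>)\<in>multi_indices n m \<times> multi_indices n' m'. F (join_index n \<beta> \<gamma>))"
    by (rule sum.reindex_bij_witness[where j = "\<lambda>\<alpha>. (head_index n \<alpha>, tail_index n \<alpha>)"
          and i = "\<lambda>(\<beta>, \<gamma>). join_index n \<beta> \<gamma>"])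
       (auto simp: join_head_tail head_index_join tail_index_join join_index_mem tail_index_mem)
  finally show ?thesis
    by (simp add: sum.cartesian_product)
qed

lemma coeff_tensor_join:
  assumes "\<beta> \<in> multi_indices n m"
  shows "coeff_tensor n m a b (join_index n \<beta> \<gamma>) = a \<beta> * b \<gamma>"
  using assms by (simp add: coeff_tensor_def head_index_join tail_index_join)

lemma hpoly_tensor:
  "hpoly (n + n') (m + m') (coeff_tensor n m a b) x = hpoly n m a x * hpoly n' m' b (tail_index n x)"
proof -
  have "hpoly (n + n') (m + m') (coeff_tensor n m a b) x =
      (\<Sum>\<beta>\<in>multi_indices n m. \<Sum>\<gamma>\<in>multi_indices n' m'. coeff_tensor n m a b (join_index n \<beta> \<gamma>) *
         (\<Prod>i<n + n'. x i ^ join_index n \<beta> \<gamma> i))"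
    unfolding hpoly_def by (rule sum_multi_indices_join) (simp add: coeff_tensor_def)
  also have "\<dots> = (\<Sum>\<beta>\<in>multi_indices n m. \<Sum>\<gamma>\<in>multi_indices n' m'.
      (a \<beta> * (\<Prod>i<n. x i ^ \<beta> i)) * (b \<gamma> * (\<Prod>i<n'. tail_index n x i ^ \<gamma> i)))"
  proof (intro sum.cong refl)
    fix \<beta> \<gamma>
    assume "\<beta> \<in> multi_indices n m"
    moreover have "(\<Prod>i<n + n'. x i ^ join_index n \<beta> \<gamma> i) =
        (\<Prod>i<n. x i ^ \<beta> i) * (\<Prod>i<n'. tail_index n x i ^ \<gamma> i)"
      by (simp add: prod_lessThan_add_split join_index_def tail_index_def)
    ultimately show "coeff_tensor n m a b (join_index n \<beta> \<gamma>) * (\<Prod>i<n + n'. x i ^ join_index n \<beta> \<gamma> i) =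
        (a \<beta> * (\<Prod>i<n. x i ^ \<beta> i)) * (b \<gamma> * (\<Prod>i<n'. tail_index n x i ^ \<gamma> i))"
      by (simp add: coeff_tensor_join)
  qed
  finally show ?thesis
    by (simp add: hpoly_def sum_product)
qed

text \<open>Since the variables are disjoint, each monomial of the product arises from just one pair
  of monomials. Nothing cancels, so the power sums multiply.\<close>

lemma coeff_power_sum_tensor:
  "(\<Sum>\<alpha>\<in>multi_indices (n + n') (m + m'). \<bar>coeff_tensor n m a b \<alpha>\<bar> powr p) =
   (\<Sum>\<beta>\<in>multi_indices n m. \<bar>a \<beta>\<bar> powr p) * (\<Sum>\<gamma>\<in>multi_indices n' m'. \<bar>b \<gamma>\<bar> powr p)"
proof -
  have "(\<Sum>\<alpha>\<in>multi_indices (n + n') (m + m'). \<bar>coeff_tensor n m a b \<alpha>\<bar> powr p) =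
    (\<Sum>\<beta>\<in>multi_indices n m. \<Sum>\<gamma>\<in>multi_indices n' m'.
       \<bar>coeff_tensor n m a b (join_index n \<beta> \<gamma>)\<bar> powr p)"
    by (rule sum_multi_indices_join) (simp add: coeff_tensor_def)
  also have "\<dots> = (\<Sum>\<beta>\<in>multi_indices n m. \<Sum>\<gamma>\<in>multi_indices n' m'. \<bar>a \<beta>\<bar> powr p * \<bar>b \<gamma>\<bar> powr p)"
    by (intro sum.cong refl) (simp add: coeff_tensor_join abs_mult powr_mult)
  finally show ?thesis
    by (simp add: sum_product)
qed

definition cube_example :: "nat \<Rightarrow> nat \<Rightarrow> real \<Rightarrow> real \<Rightarrow> ((nat \<Rightarrow> nat) \<Rightarrow> real) \<Rightarrow> bool" where
  "cube_example n m S M a \<longleftrightarrow>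
     (\<forall>p. (\<Sum>\<alpha>\<in>multi_indices n m. \<bar>a \<alpha>\<bar> powr p) = S) \<and>
     (\<forall>x. (\<forall>i<n. \<bar>x i\<bar> \<le> 1) \<longrightarrow> \<bar>hpoly n m a x\<bar> \<le> M)"

lemma cube_example_tensor:
  assumes a: "cube_example n m S M a" and b: "cube_example n' m' S' M' b"
  shows "cube_example (n + n') (m + m') (S * S') (M * M') (coeff_tensor n m a b)"
  unfolding cube_example_def
proof (intro conjI allI impI)
  show "(\<Sum>\<alpha>\<in>multi_indices (n + n') (m + m'). \<bar>coeff_tensor n m a b \<alpha>\<bar> powr p) = S * S'" for p
    using a b by (simp add: cube_example_def coeff_power_sum_tensor)
next
  fix x :: "nat \<Rightarrow> real"
  assume x: "\<forall>i<n + n'. \<bar>x i\<bar> \<le> 1"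
  have "\<bar>hpoly n m a x\<bar> \<le> M"
    using a x by (simp add: cube_example_def)
  moreover have "\<bar>hpoly n' m' b (tail_index n x)\<bar> \<le> M'"
    using b x by (simp add: cube_example_def tail_index_def)
  ultimately show "\<bar>hpoly (n + n') (m + m') (coeff_tensor n m a b) x\<bar> \<le> M * M'"
    by (simp add: hpoly_tensor abs_mult mult_mono')
qed

section \<open>The quadratic form on the square\<close>

lemma multi_indices_0_0: "multi_indices 0 0 = {\<lambda>_. 0}"
  by (auto simp: multi_indices_def)

lemma multi_indices_1: "multi_indices 1 m = {(\<lambda>_. 0)(0 := m)}"
  by (auto simp: multi_indices_def fun_eq_iff)

lemma multi_indices_2_2:
  "multi_indices 2 2 = {(\<lambda>_. 0)(0 := 2), (\<lambda>_. 0)(0 := 1, 1 := 1), (\<lambda>_. 0)(1 := 2)}"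
  (is "_ = {?f, ?g, ?h}")
proof
  show "multi_indices 2 2 \<subseteq> {?f, ?g, ?h}"
  proof
    fix \<alpha> assume "\<alpha> \<in> multi_indices 2 2"
    then have z: "\<And>i. i \<ge> 2 \<Longrightarrow> \<alpha> i = 0" and s: "\<alpha> 0 + \<alpha> 1 = 2"
      by (auto simp: multi_indices_def numeral_2_eq_2)
    have "\<alpha> = (\<lambda>_. 0)(0 := \<alpha> 0, 1 := \<alpha> 1)"
    proof
      fix i :: nat
      consider "i = 0" | "i = 1" | "i \<ge> 2" by linarith
      then show "\<alpha> i = ((\<lambda>_. 0)(0 := \<alpha> 0, 1 := \<alpha> 1)) i"
        by cases (auto simp: z)
    qed
    then obtain p q where \<alpha>: "\<alpha> = (\<lambda>_. 0)(0 := p, 1 := q)" and "p + q = 2"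
      using s by blast
    then consider "p = 2" "q = 0" | "p = 1" "q = 1" | "p = 0" "q = 2"
      by linarith
    then show "\<alpha> \<in> {?f, ?g, ?h}"
      unfolding \<alpha> by cases (simp_all add: fun_upd_idem)
  qed
  show "{?f, ?g, ?h} \<subseteq> multi_indices 2 2"
    by (auto simp: multi_indices_def numeral_2_eq_2)
qed

lemma sum_multi_indices_2_2:
  "(\<Sum>\<alpha>\<in>multi_indices 2 2. F \<alpha>) =
     F ((\<lambda>_. 0)(0 := 2)) + F ((\<lambda>_. 0)(0 := 1, 1 := 1)) + (F ((\<lambda>_. 0)(1 := 2)) :: real)"
proof -
  \<comment> \<open>Distinctness lets the sum over the explicit set expand into three terms.\<close>
  have "(\<lambda>_::nat. 0::nat)(0 := 2) \<noteq> (\<lambda>_. 0)(0 := 1, 1 := 1)" "(\<lambda>_::nat. 0::nat)(0 := 2) \<noteq> (\<lambda>_. 0)(1 := 2)"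
    "(\<lambda>_::nat. 0::nat)(0 := 1, 1 := 1) \<noteq> (\<lambda>_. 0)(1 := 2)"
    by (auto simp: fun_eq_iff)
  then show ?thesis
    unfolding multi_indices_2_2 by (simp add: add.assoc)
qed

text \<open>Completing the square in \<open>y\<close> bounds the form above by 5/4 x^2, and
  completing it in \<open>x\<close> bounds it below by -5/4 y^2.\<close>

lemma quadratic_cube_bound:
  fixes x y :: real
  assumes "\<bar>x\<bar> \<le> 1" "\<bar>y\<bar> \<le> 1"
  shows "\<bar>x\<^sup>2 + x * y - y\<^sup>2\<bar> \<le> 5 / 4"
proof -
  have "x\<^sup>2 \<le> 1" "y\<^sup>2 \<le> 1"
    using assms by (simp_all add: abs_square_le_1)
  moreover have "x\<^sup>2 + x * y - y\<^sup>2 = 5 / 4 * x\<^sup>2 - (y - x / 2)\<^sup>2"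
    "x\<^sup>2 + x * y - y\<^sup>2 = (x + y / 2)\<^sup>2 - 5 / 4 * y\<^sup>2"
    by (simp_all add: power2_eq_square field_simps)
  ultimately show ?thesis
    using zero_le_power2[of "y - x / 2"] zero_le_power2[of "x + y / 2"] by linarith
qed

lemma cube_example_quadratic: "cube_example 2 2 3 (5 / 4) (\<lambda>\<alpha>. if \<alpha> 1 = 2 then - 1 else 1)"
proof -
  let ?a = "\<lambda>\<alpha> :: nat \<Rightarrow> nat. if \<alpha> 1 = 2 then - 1 else 1 :: real"
  have "hpoly 2 2 ?a x = (x 0)\<^sup>2 + x 0 * x 1 - (x 1)\<^sup>2" for x
    unfolding hpoly_def sum_multi_indices_2_2 by (simp add: numeral_2_eq_2)
  then have "\<bar>hpoly 2 2 ?a x\<bar> \<le> 5 / 4" if "\<forall>i<2. \<bar>x i\<bar> \<le> 1" for x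
    using that by (simp only:) (rule quadratic_cube_bound, auto)
  moreover have "(\<Sum>\<alpha>\<in>multi_indices 2 2. \<bar>?a \<alpha>\<bar> powr p) = 3" for p
    unfolding sum_multi_indices_2_2 by simp
  ultimately show ?thesis
    unfolding cube_example_def by blast
qed

section \<open>Product examples and the lower bounds they give\<close>

lemma cube_example_power:
  assumes "cube_example n m S M a"
  shows "\<exists>b. cube_example (k * n) (k * m) (S ^ k) (M ^ k) b"
proof (induction k)
  case 0
  \<comment> \<open>The empty product: the constant 1 in no variables.\<close>
  have "cube_example 0 0 1 1 (\<lambda>_. 1)"
    by (simp add: cube_example_def hpoly_def multi_indices_0_0)
  then show ?case by auto
next
  case (Suc k)
  then show ?case
    using cube_example_tensor[OF assms] by (metis mult_Suc power_Suc)
qed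

lemma cube_example_even: "\<exists>a. cube_example (2 * k) (2 * k) (3 ^ k) ((5 / 4) ^ k) a"
  using cube_example_power[OF cube_example_quadratic, of k] by (simp add: mult.commute)

lemma cube_example_odd: "\<exists>a. cube_example (2 * k + 1) (2 * k + 1) (3 ^ k) ((5 / 4) ^ k) a"
proof -
  \<comment> \<open>The extra factor is a single variable: it raises degree and dimension by one and
    leaves \<open>S\<close> and \<open>M\<close> unchanged.\<close>
  have "cube_example 1 1 1 1 (\<lambda>_. 1)"
    unfolding cube_example_def hpoly_def multi_indices_1 by simp
  then show ?thesis
    using cube_example_even[of k] cube_example_tensor[of "2 * k" "2 * k" "3 ^ k" "(5 / 4) ^ k" _ 1 1 1 1]
    by (metis mult.right_neutral)
qed

text \<open>For p = 2m/(m+1) the exponent (m+1)/(2m) is 1/p, so every admissible \<open>D\<close>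
  satisfies S^(1/p) = |P|_p <= D ||P|| <= D M.\<close>

lemma BH_const_ge:
  assumes "cube_example n m S M a" "n \<ge> 1" "M > 0"
  shows "ereal (S powr ((real m + 1) / (2 * real m)) / M) \<le> BH_const m"
  unfolding BH_const_def
proof (rule Inf_greatest, safe)
  fix D :: real
  assume D: "D > 0"
    and "\<forall>n\<ge>1. \<forall>a. coeff_norm (2 * real m / (real m + 1)) n m a \<le> D * poly_norm n m a"
  then have "coeff_norm (2 * real m / (real m + 1)) n m a \<le> D * poly_norm n m a"
    using assms(2) by blast
  moreover have "coeff_norm (2 * real m / (real m + 1)) n m a = S powr ((real m + 1) / (2 * real m))"
    using assms(1) by (simp add: coeff_norm_def cube_example_def)
  moreover have "poly_norm n m a \<le> M"
    unfolding poly_norm_def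
  proof (rule cSUP_least)
    show "{..<n} \<rightarrow>\<^sub>E {- 1..1 :: real} \<noteq> {}"
      by (simp add: PiE_eq_empty_iff)
    show "\<bar>hpoly n m a x\<bar> \<le> M" if "x \<in> {..<n} \<rightarrow>\<^sub>E {- 1..1}" for x
    proof -
      have "\<forall>i<n. \<bar>x i\<bar> \<le> 1"
        using that by (auto simp: PiE_iff abs_le_iff)
      then show ?thesis
        using assms(1) by (simp add: cube_example_def)
    qed
  qed
  ultimately have "S powr ((real m + 1) / (2 * real m)) \<le> D * M"
    using D by (metis less_eq_real_def mult_left_mono order_trans)
  then show "ereal (S powr ((real m + 1) / (2 * real m)) / M) \<le> ereal D"
    using assms(3) by (simp add: pos_divide_le_eq)
qed

section \<open>Numerical comparison of the two norms\<close>

lemma root_4_3_power: "root 4 3 ^ m = 3 powr (real m / 4)"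
  by (simp add: root_powr_inverse powr_powr flip: powr_realpow)

lemma power_powr:
  fixes x :: real
  shows "x > 0 \<Longrightarrow> (x ^ k) powr e = x powr (real k * e)"
  by (simp add: powr_powr flip: powr_realpow)

text \<open>For m = 2k the factor (2 / sqrt 5)^m = (4/5)^k matches the norm bound exactly. What
  remains is the exponent of 3: m/4 on the left against k(m+1)/(2m) = (m+1)/4 on the right.\<close>

lemma even_bound:
  assumes "k > 0"
  shows "(2 * root 4 3 / sqrt 5) ^ (2 * k) <
    (3 ^ k) powr ((real (2 * k) + 1) / (2 * real (2 * k))) / (5 / 4) ^ k"
proof -
  have "(2 * root 4 3 / sqrt 5) ^ (2 * k) = 3 powr (real (2 * k) / 4) * (2 / sqrt 5) ^ (2 * k)"
    unfolding root_4_3_power[symmetric] by (simp add: power_mult_distrib power_divide)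
  also have "(2 / sqrt 5) ^ (2 * k) = 1 / (5 / 4 :: real) ^ k"
    by (simp add: power_mult power_divide)
  also have "3 powr (real (2 * k) / 4) * (1 / (5 / 4) ^ k) < 3 powr ((2 * real k + 1) / 4) * (1 / (5 / 4 :: real) ^ k)"
    by (intro mult_strict_right_mono powr_less_mono) auto
  also have "3 powr ((2 * real k + 1) / 4) = (3 ^ k :: real) powr ((real (2 * k) + 1) / (2 * real (2 * k)))"
  proof -
    have "(2 * real k + 1) / 4 = real k * ((real (2 * k) + 1) / (2 * real (2 * k)))"
      using assms by (simp add: field_simps)
    then show ?thesis
      by (simp only: power_powr zero_less_numeral)
  qed
  finally show ?thesis by simp
qed

text \<open>Needed for odd degree, where one factor sqrt 5 / 2 must absorb a deficit of at most 1/12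
  in the exponent of 3. Twelfth powers clear both roots.\<close>

lemma three_powr_twelfth: "3 powr (1 / 12) < sqrt 5 / 2"
proof (rule power_less_imp_less_base)
  have "(3 powr (1 / 12)) ^ 12 = (3 :: real)"
    using powr_realpow[of "3 powr (1 / 12) :: real" 12] by (simp add: powr_powr)
  also have "3 < (5 / 4 :: real) ^ 6"
    by (simp add: power_divide)
  also have "\<dots> = (sqrt 5 / 2) ^ 12"
    using power_mult[of "sqrt 5 / 2" 2 6] by (simp add: power_divide)
  finally show "(3 powr (1 / 12)) ^ 12 < (sqrt 5 / 2) ^ 12" .
qed simp

text \<open>For m = 2k + 1 there are only k quadratic factors, so the exponent of 3 on the right,
  k(m+1)/(2m) = \<open>?e\<close>, falls short of m/4 by 1/(4m). The unpaired factor 2 / sqrt 5 on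
  the left compensates for this.\<close>

lemma odd_bound:
  assumes "k > 0"
  shows "(2 * root 4 3 / sqrt 5) ^ (2 * k + 1) <
    (3 ^ k) powr ((real (2 * k + 1) + 1) / (2 * real (2 * k + 1))) / (5 / 4) ^ k"
proof -
  let ?e = "real k * (real k + 1) / (2 * real k + 1)"
  have "(2 * real k + 1) / 4 = ?e + 1 / (4 * (2 * real k + 1))"
    by (simp add: divide_simps) (simp add: algebra_simps)
  moreover have "1 / (4 * (2 * real k + 1)) \<le> 1 / 12"
    \<comment> \<open>Here k >= 1 gives 2k + 1 >= 3; the worst case is m = 3.\<close>
    using assms by (intro divide_left_mono) auto
  ultimately have "(2 * real k + 1) / 4 \<le> ?e + 1 / 12"
    by linarith
  then have "3 powr ((2 * real k + 1) / 4) \<le> 3 powr ?e * 3 powr (1 / 12)"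
    by (simp flip: powr_add)
  also have "\<dots> < 3 powr ?e * (sqrt 5 / 2)"
    using three_powr_twelfth by simp
  finally have *: "3 powr ((2 * real k + 1) / 4) * (2 / sqrt 5) < 3 powr ?e"
    by (simp add: field_simps)
  have "(2 * root 4 3 / sqrt 5) ^ (2 * k + 1) =
      3 powr (real (2 * k + 1) / 4) * (2 / sqrt 5) ^ (2 * k + 1)"
    unfolding root_4_3_power[symmetric] by (simp add: power_mult_distrib power_divide)
  also have "(2 / sqrt 5) ^ (2 * k + 1) = 2 / sqrt 5 * (1 / (5 / 4 :: real) ^ k)"
    by (simp add: power_mult power_divide)
  also have "3 powr (real (2 * k + 1) / 4) * (2 / sqrt 5 * (1 / (5 / 4) ^ k)) =
      3 powr ((2 * real k + 1) / 4) * (2 / sqrt 5) * (1 / (5 / 4) ^ k)"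
    by (simp add: add.commute)
  also have "\<dots> < 3 powr ?e * (1 / (5 / 4) ^ k)"
    using * by (intro mult_strict_right_mono) auto
  also have "3 powr ?e = (3 ^ k) powr ((real (2 * k + 1) + 1) / (2 * real (2 * k + 1)))"
  proof -
    have "?e = real k * ((real (2 * k + 1) + 1) / (2 * real (2 * k + 1)))"
      by (simp add: divide_simps) (simp add: algebra_simps)
    then show ?thesis
      by (simp only: power_powr zero_less_numeral)
  qed
  finally show ?thesis by simp
qed

text \<open>Fourth powers clear the roots: 1.17^4 < 1.88 < 48/25.\<close>

lemma base_gt: "1.17 < 2 * root 4 3 / sqrt 5"
proof (rule power_less_imp_less_base)
  have "sqrt 5 ^ 4 = 25"
    using power_mult[of "sqrt 5" 2 2] by simp
  then have "(2 * root 4 3 / sqrt 5) ^ 4 = 48 / 25"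
    by (simp add: power_mult_distrib power_divide)
  then show "(1.17 :: real) ^ 4 < (2 * root 4 3 / sqrt 5) ^ 4"
    by (simp add: power_divide)
qed simp

section \<open>The bound by parity of the degree\<close>

theorem theorem2p2:
  fixes m :: nat
  assumes "m > 1"
  shows "BH_const m > ereal ((2 * root 4 3 / sqrt 5) ^ m)
       \<and> (2 * root 4 3 / sqrt 5) ^ m > (1.17 :: real) ^ m"
proof
  define k where "k = m div 2"
  have k: "k > 0"
    using assms by (simp add: k_def)
  consider "m = 2 * k" | "m = 2 * k + 1"
    unfolding k_def by linarith
  then show "BH_const m > ereal ((2 * root 4 3 / sqrt 5) ^ m)"
  proof cases
    case 1
    \<comment> \<open>The number of variables equals the degree, so \<open>n \<ge> 1\<close> in
      \<open>BH_const_ge\<close> follows from \<open>m > 1\<close>.\<close>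
    obtain a where "cube_example m m (3 ^ k) ((5 / 4) ^ k) a"
      using cube_example_even[of k] 1 by auto
    from BH_const_ge[OF this]
    have "ereal ((3 ^ k) powr ((real m + 1) / (2 * real m)) / (5 / 4) ^ k) \<le> BH_const m"
      using assms by simp
    moreover have "ereal ((2 * root 4 3 / sqrt 5) ^ m) <
        ereal ((3 ^ k) powr ((real m + 1) / (2 * real m)) / (5 / 4) ^ k)"
      using even_bound[OF k] unfolding 1 less_ereal.simps .
    ultimately show ?thesis
      by (rule order_less_le_trans[rotated])
  next
    case 2
    obtain a where "cube_example m m (3 ^ k) ((5 / 4) ^ k) a"
      using cube_example_odd[of k] 2 by auto
    from BH_const_ge[OF this]
    have "ereal ((3 ^ k) powr ((real m + 1) / (2 * real m)) / (5 / 4) ^ k) \<le> BH_const m"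
      using assms by simp
    moreover have "ereal ((2 * root 4 3 / sqrt 5) ^ m) <
        ereal ((3 ^ k) powr ((real m + 1) / (2 * real m)) / (5 / 4) ^ k)"
      using odd_bound[OF k] unfolding 2 less_ereal.simps .
    ultimately show ?thesis
      by (rule order_less_le_trans[rotated])
  qed
  show "(1.17 :: real) ^ m < (2 * root 4 3 / sqrt 5) ^ m"
    using base_gt assms by (intro power_strict_mono) auto
qed

end
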